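(* Let $s,y\in\mathbb R^n$ with $s\ne0$ and $s^Ty<0$, put $\kappa=-s^Ty>0$ and $\mathcal H_\kappa=\{v\in\mathbb R^n:s^Tv=\kappa\}$. Let $M\in\mathbb R^{n\times n}$ be symmetric positive definite. Then the problem $$\min_{v\in\mathcal H_\kappa}\ \tfrac12\|v-y\|_M^2$$ has a unique solution $\widetilde y(M)$, and it is given by $$\widetilde y(M)=y-\frac{2s^Ty}{s^TM^{-1}s}\,M^{-1}s.$$ In particular, $s^T\widetilde y(M)=\kappa>0$.
   Context: For a symmetric positive definite matrix $M$, $\|u\|_M^2:=u^TMu$. *)

theory Defs
  imports "HOL-Analysis.Analysis"
begin

definition sym_pos_def :: "real ^ 'n ^ 'n \<Rightarrow> bool" where
  "sym_pos_def M \<longleftrightarrow> transpose M = M \<and> (\<forall>x. x \<noteq> 0 \<longrightarrow> 0 < x \<bullet> (M *v x))"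

(* The squared weighted norm is the primitive notion; it is meant for
   symmetric positive definite M. *)
definition wnorm_sq :: "real ^ 'n ^ 'n \<Rightarrow> real ^ 'n \<Rightarrow> real" where
  "wnorm_sq M u = u \<bullet> (M *v u)"

definition affine_hyperplane :: "real ^ 'n \<Rightarrow> real \<Rightarrow> (real ^ 'n) set" where
  "affine_hyperplane s \<kappa> = {v. s \<bullet> v = \<kappa>}"

definition is_solution ::
  "real ^ 'n ^ 'n \<Rightarrow> real ^ 'n \<Rightarrow> real ^ 'n \<Rightarrow> real \<Rightarrow> real ^ 'n \<Rightarrow> bool" where
  "is_solution M s y \<kappa> v \<longleftrightarrow>
     is_arg_min (\<lambda>w. (1 / 2) * wnorm_sq M (w - y)) (\<lambda>w. w \<in> affine_hyperplane s \<kappa>) v"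

(* Meaningful only when the solution exists and is unique. *)
definition y_tilde ::
  "real ^ 'n ^ 'n \<Rightarrow> real ^ 'n \<Rightarrow> real ^ 'n \<Rightarrow> real \<Rightarrow> real ^ 'n" where
  "y_tilde M s y \<kappa> = (THE v. is_solution M s y \<kappa> v)"

end

theory Submission
  imports Defs
begin

text \<open>
  Put \<open>z = M\<^sup>-\<^sup>1 s\<close> and let \<open>p\<close> be the claimed solution, so that \<open>p - y\<close> is a multiple of \<open>z\<close>.
  For \<open>w\<close> in the hyperplane, \<open>w - p\<close> is orthogonal to \<open>s = M z\<close>, i.e. \<open>M\<close>-orthogonal to \<open>p - y\<close>.
  Pythagoras then exhibits \<open>p\<close> as the strict minimiser.
\<close>

lemma sym_pos_def_pos: "sym_pos_def M \<Longrightarrow> x \<noteq> 0 \<Longrightarrow> 0 < x \<bullet> (M *v x)"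
  by (simp add: sym_pos_def_def)

lemma sym_pos_def_symmetric:
  assumes "sym_pos_def M"
  shows "x \<bullet> (M *v u) = u \<bullet> (M *v x)"
  using assms dot_lmul_matrix[of x M u] transpose_matrix_vector[of M x]
  by (simp add: sym_pos_def_def inner_commute)

text \<open>Positive definiteness forces a trivial kernel, hence a left inverse, and a left inverse
  of a square matrix is two-sided.\<close>

lemma sym_pos_def_mult_matrix_inv:
  fixes M :: "real ^ 'n ^ 'n"
  assumes "sym_pos_def M"
  shows "M *v (matrix_inv M *v x) = x"
proof -
  have "x = 0" if "M *v x = 0" for x
    using sym_pos_def_pos[OF assms, of x] that by force
  then obtain B where "B ** M = mat 1"
    using matrix_left_invertible_ker by blast
  then have "invertible M"
    using invertible_left_inverse by blast
  \<comment> \<open>\<open>matrix_inv\<close> is a Hilbert choice, so invertibility supplies the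
    witness it requires.\<close>
  then have "M ** matrix_inv M = mat 1"
    unfolding invertible_def matrix_inv_def by (rule someI2_ex) simp
  then show ?thesis
    by (simp add: matrix_vector_mul_assoc)
qed

lemma wnorm_sq_pos: "sym_pos_def M \<Longrightarrow> u \<noteq> 0 \<Longrightarrow> 0 < wnorm_sq M u"
  by (simp add: wnorm_sq_def sym_pos_def_pos)

lemma wnorm_sq_add_orthogonal:
  assumes "sym_pos_def M" and "u \<bullet> (M *v x) = 0"
  shows "wnorm_sq M (u + x) = wnorm_sq M u + wnorm_sq M x"
  using assms sym_pos_def_symmetric[OF assms(1), of x u]
  by (simp add: wnorm_sq_def matrix_vector_right_distrib inner_add_left inner_add_right)

text \<open>\<open>grad\<close> is the Lagrange condition: the gradient of the objective at
  \<open>p\<close> is a multiple of the normal \<open>s\<close>. The equivalence yields existence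
  and uniqueness together and evaluates the \<open>THE\<close> in \<open>y_tilde\<close>.\<close>

lemma is_solution_iff:
  fixes M :: "real ^ 'n ^ 'n"
  assumes M: "sym_pos_def M" and p: "s \<bullet> p = \<kappa>" and grad: "M *v (p - y) = c *\<^sub>R s"
  shows "is_solution M s y \<kappa> v \<longleftrightarrow> v = p"
proof -
  have less: "wnorm_sq M (p - y) < wnorm_sq M (w - y)" if "s \<bullet> w = \<kappa>" "w \<noteq> p" for w
  proof -
    have "(w - p) \<bullet> (M *v (p - y)) = 0"
      using that p by (simp add: grad inner_diff_right inner_commute[of _ s])
    from wnorm_sq_add_orthogonal[OF M this]
    have "wnorm_sq M (w - y) = wnorm_sq M (w - p) + wnorm_sq M (p - y)"
      by simp
    with wnorm_sq_pos[OF M, of "w - p"] that show ?thesis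
      by simp
  qed
  show ?thesis
  proof
    assume "is_solution M s y \<kappa> v"
    then show "v = p"
      using less[of v] p by (auto simp: is_solution_def is_arg_min_def affine_hyperplane_def)
  next
    assume "v = p"
    then show "is_solution M s y \<kappa> v"
      using less p
      by (force simp: is_solution_def is_arg_min_def affine_hyperplane_def)
  qed
qed

theorem proposition5p1:
  fixes s y :: "real ^ 'n" and M :: "real ^ 'n ^ 'n" and \<kappa> :: real
  assumes "s \<noteq> 0"
    and "s \<bullet> y < 0"
    and "\<kappa> = - (s \<bullet> y)"
    and "sym_pos_def M"
  shows "(\<exists>!v. is_solution M s y \<kappa> v)
    \<and> y_tilde M s y \<kappa> =
        y - (2 * (s \<bullet> y) / (s \<bullet> (matrix_inv M *v s))) *\<^sub>R (matrix_inv M *v s)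
    \<and> s \<bullet> y_tilde M s y \<kappa> = \<kappa> \<and> \<kappa> > 0"
proof -
  define z where "z = matrix_inv M *v s"
  \<comment> \<open>The factor 2 makes \<open>p\<close> feasible: \<open>s \<bullet> p = s \<bullet>
    y - 2 * (s \<bullet> y) = \<kappa>\<close>.\<close>
  define c where "c = 2 * (s \<bullet> y) / (s \<bullet> z)"
  define p where "p = y - c *\<^sub>R z"
  have Mz: "M *v z = s"
    by (simp add: z_def sym_pos_def_mult_matrix_inv[OF assms(4)])
  with assms(1) have "z \<noteq> 0"
    by auto
  \<comment> \<open>As \<open>s = M *v z\<close>, this is positivity of the quadratic form at
    \<open>z\<close>; it makes the division in \<open>c\<close> genuine.\<close>
  from sym_pos_def_pos[OF assms(4) this] have "s \<bullet> z > 0"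
    by (simp add: Mz inner_commute)
  then have p: "s \<bullet> p = \<kappa>"
    by (simp add: p_def c_def assms(3) inner_diff_right)
  have "M *v (p - y) = (- c) *\<^sub>R s"
    using matrix_vector_mult_scaleR[of M "- c" z] by (simp add: p_def Mz)
  note sol = is_solution_iff[OF assms(4) p this]
  then have "y_tilde M s y \<kappa> = p"
    by (simp add: y_tilde_def)
  with sol p assms(2,3) show ?thesis
    by (simp add: p_def c_def z_def)
qed

end
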